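(* Let $k$ be a positive integer. For each positive integer $n$, let $x_n = 0.(kn)(k(n+1))(k(n+2))(k(n+3))\dots$ be the real number whose decimal expansion after the decimal point is obtained by concatenating the decimal representations of the integers $kn, k(n+1), k(n+2), \dots$ in this order. Then the sequence $(x_n)_{n\ge1}$ is not uniformly distributed modulo $1$ over $[0.1,1)$.
   Context: For a real number $x$, $\{x\}$ denotes its fractional part. For a sequence of real numbers $(x_n)_n$, a set $E\subseteq[0,1]$ and $N\ge 1$, $A(E;N;(x_n)_n)$ denotes the number of indices $n$ with $1\le n\le N$ and $\{x_n\}\in E$. A sequence $(x_n)_n$ is called uniformly distributed modulo $1$ over $[\alpha,\beta)\subseteq[0,1)$ if for every pair of reals $\alpha\le a<b\le\beta$, $$\lim_{N\to\infty}\frac{A([a,b);N;(x_n)_n)}{N}=\frac{b-a}{\beta-\alpha}.$$ *)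

theory Defs
  imports Complex_Main "HOL-Library.Stream"
begin

text \<open>Decimal representation, most significant digit first, without leading zeros.\<close>

fun dec_digits :: "nat \<Rightarrow> nat list" where
  "dec_digits m = (if m < 10 then [m] else dec_digits (m div 10) @ [m mod 10])"

declare dec_digits.simps [simp del]

text \<open>
  No block \<open>dec_digits (k * (n + j))\<close> is empty, so \<open>flat\<close> really is the
  infinite concatenation of the blocks \<open>j = 0, 1, 2, \<dots>\<close>.
\<close>

definition concat_digits :: "nat \<Rightarrow> nat \<Rightarrow> nat stream" where
  "concat_digits k n = flat (smap (\<lambda>j. dec_digits (k * (n + j))) nats)"

definition decimal_expansion :: "nat stream \<Rightarrow> real" where
  "decimal_expansion ds = (\<Sum>i. real (ds !! i) / 10 ^ (i + 1))"

definition concat_seq :: "nat \<Rightarrow> nat \<Rightarrow> real" where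
  "concat_seq k n = decimal_expansion (concat_digits k n)"

definition count_mod1 :: "real set \<Rightarrow> nat \<Rightarrow> (nat \<Rightarrow> real) \<Rightarrow> nat" where
  "count_mod1 E N x = card {n \<in> {1..N}. frac (x n) \<in> E}"

text \<open>Intended for \<open>0 \<le> \<alpha> < \<beta> \<le> 1\<close>. The value \<open>x 0\<close> plays no role.\<close>

definition uniformly_distributed_mod1_over :: "real \<Rightarrow> real \<Rightarrow> (nat \<Rightarrow> real) \<Rightarrow> bool" where
  "uniformly_distributed_mod1_over \<alpha> \<beta> x \<longleftrightarrow>
     (\<forall>a b. \<alpha> \<le> a \<and> a < b \<and> b \<le> \<beta> \<longrightarrow>
        (\<lambda>N. real (count_mod1 {a..<b} N x) / real N) \<longlonglongrightarrow> (b - a) / (\<beta> - \<alpha>))"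

end

(* The leading digit of x_n is that of k * n. For L = 10^m div k and L < n <= 2 * L it is 1 or 2,
   so at least half of x_1, ..., x_2L lie in [1/10, 4/10), where uniform distribution would put
   asymptotically only a third. *)

theory Submission
  imports Defs
begin

lemma dec_digits_nonempty: "dec_digits m \<noteq> []"
  by (subst dec_digits.simps) auto

lemma dec_digits_le_9: "d \<in> set (dec_digits m) \<Longrightarrow> d \<le> 9"
proof (induction m rule: dec_digits.induct)
  case (1 m)
  then show ?case
    by (subst (asm) (2) dec_digits.simps) (auto split: if_splits)
qed

text \<open>Induction on \<open>e\<close>: passing from \<open>m\<close> to \<open>m div 10\<close>
  drops the last digit, keeps the leading one and lowers the exponent in both bounds by one.\<close>

lemma hd_dec_digits:
  assumes "d > 0" "d \<le> 9" "d * 10 ^ e \<le> m" "m < (d + 1) * 10 ^ e"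
  shows "hd (dec_digits m) = d"
  using assms(3,4)
proof (induction e arbitrary: m)
  case 0
  with assms show ?case by (subst dec_digits.simps) auto
next
  case (Suc e)
  \<comment> \<open>Since \<open>d > 0\<close>, the number \<open>m\<close> has at least two digits,
    so \<open>dec_digits\<close> unfolds to its recursive branch and the head comes from
    \<open>m div 10\<close>.\<close>
  have "10 ^ Suc e \<le> d * 10 ^ Suc e" using \<open>d > 0\<close> by simp
  moreover have "(10::nat) \<le> 10 ^ Suc e" by simp
  ultimately have "10 \<le> m" using Suc.prems(1) by linarith
  moreover have "hd (dec_digits (m div 10)) = d"
    using Suc.prems by (intro Suc.IH) auto
  ultimately show ?case
    by (subst dec_digits.simps) (simp add: hd_append dec_digits_nonempty)
qed

lemma shd_concat_digits: "shd (concat_digits k n) = hd (dec_digits (k * n))"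
  by (simp add: concat_digits_def dec_digits_nonempty)

lemma concat_digits_le_9: "concat_digits k n !! i \<le> 9"
proof -
  have "concat_digits k n !! i \<in> sset (concat_digits k n)"
    by (rule snth_sset)
  then show ?thesis
    unfolding concat_digits_def
    by (subst (asm) sset_flat) (auto simp: dec_digits_nonempty stream.set_map dest: dec_digits_le_9)
qed

text \<open>The digits after the first contribute at least 0 and at most 0.0999... = 1/10. The upper
  bound is not strict, because a tail consisting only of nines is allowed.\<close>

lemma decimal_expansion_bounds:
  assumes "\<And>i. ds !! i \<le> 9"
  shows "real (shd ds) / 10 \<le> decimal_expansion ds"
    and "decimal_expansion ds \<le> (real (shd ds) + 1) / 10"
proof -
  let ?f = "\<lambda>i. real (ds !! i) / 10 ^ (i + 1)"
  \<comment> \<open>The tail with every digit equal to 9: its terms are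
    \<open>9 / 10 ^ (i + 2)\<close>.\<close>
  let ?g = "\<lambda>i. (9 / 100) * (1 / 10 :: real) ^ i"
  have g: "?g sums (1 / 10)"
    using sums_mult[OF geometric_sums[of "1 / 10 :: real"], of "9 / 100"] by simp
  have le: "?f (Suc i) \<le> ?g i" for i
  proof -
    have "real (ds !! Suc i) \<le> 9" using assms[of "Suc i"] by linarith
    then show ?thesis by (simp add: field_simps)
  qed
  have tail: "summable (\<lambda>i. ?f (Suc i))"
    by (rule summable_comparison_test'[OF sums_summable[OF g], of 0]) (use le in simp)
  then have f: "summable ?f" by (subst (asm) summable_Suc_iff)
  have split: "decimal_expansion ds = real (shd ds) / 10 + (\<Sum>i. ?f (Suc i))"
    using suminf_split_head[OF f] by (simp add: decimal_expansion_def)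
  have "0 \<le> (\<Sum>i. ?f (Suc i))"
    by (rule suminf_nonneg[OF tail]) simp
  then show "real (shd ds) / 10 \<le> decimal_expansion ds" using split by simp
  have "(\<Sum>i. ?f (Suc i)) \<le> (\<Sum>i. ?g i)"
    by (rule suminf_le[OF le tail sums_summable[OF g]])
  also have "\<dots> = 1 / 10" using g by (rule sums_unique[symmetric])
  finally show "decimal_expansion ds \<le> (real (shd ds) + 1) / 10"
    using split by (simp add: add_divide_distrib)
qed

text \<open>The leading digit is 1, or 2 at the closed right endpoint, which is attained for
  \<open>n = 2 * L\<close> when \<open>k\<close> divides the power of ten. So the value is at most
  3/10, possibly with equality as far as the bounds tell; the half-open interval up to 4/10 leaves
  room for that.\<close>

lemma frac_concat_seq:
  assumes "10 ^ e \<le> k * n" "k * n \<le> 2 * 10 ^ e"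
  shows "frac (concat_seq k n) \<in> {1 / 10..<4 / 10}"
proof -
  let ?d = "hd (dec_digits (k * n))"
  have "?d = 1 \<or> ?d = 2"
  proof (cases "k * n < 2 * 10 ^ e")
    case True
    then show ?thesis using assms hd_dec_digits[of 1 e "k * n"] by simp
  next
    case False
    with assms(2) have "k * n = 2 * 10 ^ e" by simp
    then show ?thesis using hd_dec_digits[of 2 e "k * n"] by simp
  qed
  then have "1 / 10 \<le> concat_seq k n" "concat_seq k n \<le> 3 / 10"
    using decimal_expansion_bounds[of "concat_digits k n", OF concat_digits_le_9]
    unfolding concat_seq_def shd_concat_digits by auto
  moreover from this have "frac (concat_seq k n) = concat_seq k n"
    by (simp add: frac_eq)
  ultimately show ?thesis by simp
qed

text \<open>As \<open>L\<close> is a quotient rounded down, \<open>k * n\<close> exceeds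
  \<open>10 ^ m\<close> as soon as \<open>n > L\<close>, and is at most \<open>2 * 10 ^ m\<close> as
  long as \<open>n \<le> 2 * L\<close>. All \<open>L\<close> indices in between are therefore
  counted.\<close>

lemma count_mod1_concat_seq_ge:
  fixes k m :: nat
  assumes "k > 0"
  defines "L \<equiv> 10 ^ m div k"
  shows "L \<le> count_mod1 {1 / 10..<4 / 10} (2 * L) (concat_seq k)"
proof -
  have "{L<..2 * L} \<subseteq> {n \<in> {1..2 * L}. frac (concat_seq k n) \<in> {1 / 10..<4 / 10}}"
  proof
    fix n assume n: "n \<in> {L<..2 * L}"
    have "10 ^ m \<le> k * Suc L"
      using dividend_less_times_div[OF assms(1), of "10 ^ m"] by (simp add: L_def)
    also have "\<dots> \<le> k * n" using n by (intro mult_le_mono2) simp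
    finally have "10 ^ m \<le> k * n" .
    moreover have "k * n \<le> 2 * 10 ^ m"
    proof -
      have "k * n \<le> k * (2 * L)" using n by (intro mult_le_mono2) simp
      also have "\<dots> = 2 * (k * L)" by simp
      also have "\<dots> \<le> 2 * 10 ^ m" by (simp add: L_def)
      finally show ?thesis .
    qed
    ultimately have "frac (concat_seq k n) \<in> {1 / 10..<4 / 10}" by (rule frac_concat_seq)
    with n show "n \<in> {n \<in> {1..2 * L}. frac (concat_seq k n) \<in> {1 / 10..<4 / 10}}" by simp
  qed
  then have "card {L<..2 * L} \<le> count_mod1 {1 / 10..<4 / 10} (2 * L) (concat_seq k)"
    unfolding count_mod1_def by (intro card_mono) auto
  then show ?thesis by simp
qed

theorem theorem2:
  fixes k :: nat
  assumes "k > 0"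
  shows "\<not> uniformly_distributed_mod1_over (1 / 10) 1 (concat_seq k)"
proof
  let ?c = "\<lambda>N. count_mod1 {1 / 10..<4 / 10} N (concat_seq k)"
  assume "uniformly_distributed_mod1_over (1 / 10) 1 (concat_seq k)"
  then have "(\<lambda>N. real (?c N) / real N) \<longlonglongrightarrow> (4 / 10 - 1 / 10) / (1 - 1 / 10)"
    unfolding uniformly_distributed_mod1_over_def
    by (elim allE[of _ "1 / 10"] allE[of _ "4 / 10"] impE) auto
  \<comment> \<open>The limit is (3/10) / (9/10) = 1/3.\<close>
  then have "\<forall>\<^sub>F N in sequentially. real (?c N) / real N < 1 / 2"
    by (rule order_tendstoD) simp
  then obtain M where M: "\<And>N. N \<ge> M \<Longrightarrow> real (?c N) / real N < 1 / 2"
    unfolding eventually_sequentially by blast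
  \<comment> \<open>The exponent is chosen so that the power of ten is at least
    \<open>k * Suc M\<close>, which makes \<open>L\<close> exceed \<open>M\<close>.\<close>
  define L where "L = 10 ^ (k * Suc M) div k"
  have "k * Suc M \<le> 10 ^ (k * Suc M)"
    using less_exp[of "k * Suc M"] power_mono[of 2 "10 :: nat" "k * Suc M"] by linarith
  then have "Suc M \<le> L"
    unfolding L_def using assms by (metis div_le_mono nonzero_mult_div_cancel_left not_gr0)
  moreover from this have "real (?c (2 * L)) / real (2 * L) < 1 / 2"
    by (intro M) simp
  \<comment> \<open>Clearing the denominator needs \<open>L > 0\<close>, which follows from
    \<open>Suc M \<le> L\<close>.\<close>
  ultimately have "?c (2 * L) < L" by (simp add: field_simps)
  with count_mod1_concat_seq_ge[OF assms, of "k * Suc M"] show False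
    by (simp add: L_def)
qed

end
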